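(* Let $H$ be a finite-dimensional Hilbert space, let $\varepsilon>0$ and $\eta\ge0$. Let $R\neq\mathrm{Id}$ and $S\neq\mathrm{Id}$ be two orthogonal projectors on $H$ such that $\ker(R)\cap\ker(S)=\{0\}$, and let $r\in\mathrm{ran}(R)$, $s\in\mathrm{ran}(S)$, where the set $\mathcal{C}=\{f\in H:\ \|Rf-r\|\le\varepsilon,\ \|Sf-s\|\le\eta\}$ is nonempty. Consider $\tau_\sharp$ to be a (often unique) $\tau$ between $1/2$ and $\varepsilon/(\varepsilon+\eta)$ such that $$\lambda_{\min}\big((1-\tau)R+\tau S\big)-\frac{(1-\tau)^2\varepsilon^2-\tau^2\eta^2}{(1-\tau)\varepsilon^2-\tau\eta^2+(1-\tau)\tau(1-2\tau)\delta^2}=0,$$ where $\delta$ is precomputed as $$\delta=\min\{\|Rf-r\|:\ f\in H,\ Sf=s\}=\min\{\|Sf-s\|:\ f\in H,\ Rf=r\}.$$ Then the solution $f_{\tau_\sharp}$ of the regularization program $$\underset{f\in H}{\mathrm{minimize}}\ (1-\tau)\|Rf-r\|^2+\tau\|Sf-s\|^2$$ with parameter $\tau=\tau_\sharp$ is the Chebyshev center of the set $\mathcal{C}$.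
   Context: $\lambda_{\min}(T)$ denotes the smallest eigenvalue of a self-adjoint operator $T$ on $H$. "Between $1/2$ and $\varepsilon/(\varepsilon+\eta)$" refers to these two numbers in whichever order they are, endpoints not being excluded. For $\tau=1$ (which is the relevant value when $\eta=0$), the solution of the regularization program is interpreted as the minimizer of $\|Rf-r\|$ subject to $Sf=s$. The Chebyshev center of $\mathcal{C}$ is the element $\widehat f\in H$ such that $\sup_{f\in\mathcal{C}}\|f-g\|\ge\sup_{f\in\mathcal{C}}\|f-\widehat f\|$ for every $g\in H$; in a Hilbert space it is unique for a bounded nonempty set.
   Formalization: When τ♯ = 1/2, the formal theorem also assumes δ ≤ 2 min(ε, η), i.e. that the regularization solution lies in C; without this the claim fails, e.g. R = diag(0,1,1), S = diag(1,0,1), r = 0, s = (0,0,1/2), ε = 1, η = 0. *)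

theory Defs
  imports "HOL-Analysis.Analysis"
begin

definition orthogonal_projector :: "('a::real_inner \<Rightarrow> 'a) \<Rightarrow> bool" where
  "orthogonal_projector P \<longleftrightarrow>
     linear P \<and> (\<forall>x. P (P x) = P x) \<and> (\<forall>x y. P x \<bullet> y = x \<bullet> P y)"

definition eigenvalue :: "('a::real_vector \<Rightarrow> 'a) \<Rightarrow> real \<Rightarrow> bool" where
  "eigenvalue T l \<longleftrightarrow> (\<exists>v. v \<noteq> 0 \<and> T v = l *\<^sub>R v)"

definition lambda_min :: "('a::real_vector \<Rightarrow> 'a) \<Rightarrow> real" where
  "lambda_min T = (LEAST l. eigenvalue T l)"

definition is_minimum :: "real set \<Rightarrow> real \<Rightarrow> bool" where
  "is_minimum A m \<longleftrightarrow> m \<in> A \<and> (\<forall>a\<in>A. m \<le> a)"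

definition consistent_set ::
  "('a::real_normed_vector \<Rightarrow> 'a) \<Rightarrow> ('a \<Rightarrow> 'a) \<Rightarrow> 'a \<Rightarrow> 'a \<Rightarrow> real \<Rightarrow> real \<Rightarrow> 'a set" where
  "consistent_set R S r s \<epsilon> \<eta> = {f. norm (R f - r) \<le> \<epsilon> \<and> norm (S f - s) \<le> \<eta>}"

(* At \<tau> = 1 the first term of the objective vanishes. It is then minimized among the
   exact solutions of the remaining one, so that the solution stays unique. *)
definition regularization_solution ::
  "('a::real_normed_vector \<Rightarrow> 'a) \<Rightarrow> ('a \<Rightarrow> 'a) \<Rightarrow> 'a \<Rightarrow> 'a \<Rightarrow> real \<Rightarrow> 'a \<Rightarrow> bool" where
  "regularization_solution R S r s \<tau> f \<longleftrightarrow>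
     (if \<tau> = 1 then is_arg_min (\<lambda>g. norm (R g - r)) (\<lambda>g. S g = s) f
      else is_arg_min (\<lambda>g. (1 - \<tau>) * (norm (R g - r))\<^sup>2 + \<tau> * (norm (S g - s))\<^sup>2) (\<lambda>g. True) f)"

(* Boundedness and nonemptiness are part of the predicate because the real-valued
   supremum is meaningful only then. *)
definition chebyshev_center :: "'a::real_normed_vector set \<Rightarrow> 'a \<Rightarrow> bool" where
  "chebyshev_center C c \<longleftrightarrow>
     bounded C \<and> C \<noteq> {} \<and> (\<forall>g. (SUP f\<in>C. norm (f - g)) \<ge> (SUP f\<in>C. norm (f - c)))"

(* The theorem requires, for the endpoint \<tau> = 1/2 only, that \<delta> \<le> 2 * min \<epsilon> \<eta>. This means that
   the regularization solution f for \<tau> = 1/2 lies in the consistent set, because there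
   norm (R f - r) = norm (S f - s) = \<delta> / 2. It cannot be dropped: when ker R and ker S are
   orthogonal, \<tau> = 1/2 solves the equation for all \<epsilon> \<noteq> \<eta>. For example, with R = diag(0,1,1),
   S = diag(1,0,1), r = 0, s = (0,0,1/2), \<epsilon> = 1, \<eta> = 0, one has \<delta> = 1/2 and f = (0,0,1/4), but
   the Chebyshev center is (0,0,1/2). *)

end

theory Submission
  imports Defs
begin

text \<open>
  Write \<open>T = (1 - \<tau>) R + \<tau> S\<close> and let \<open>l\<close> be its smallest eigenvalue.

  The regularization solutions form a segment. There are \<open>f\<^sub>0\<close> and
  \<open>d \<in> ran R \<inter> ran S\<close> such that the solution for \<open>\<tau>\<close> is
  \<open>c = f\<^sub>0 + \<tau> d\<close>, with residuals \<open>R c - r = \<tau> d\<close> and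
  \<open>S c - s = - (1 - \<tau>) d\<close>; the number \<open>\<delta>\<close> is the norm of \<open>d\<close>
  (\<open>regularization_path_exists\<close>, \<open>is_minimum_R\<close>, \<open>regularization_solution_iff\<close>).
  When the two squared residuals at \<open>c + h\<close> are added with weights \<open>1 - \<tau>\<close> and
  \<open>\<tau>\<close>, the terms linear in \<open>h\<close> cancel (\<open>weighted_residual\<close>). With
  \<open>X = \<epsilon>\<^sup>2 - \<tau>\<^sup>2 \<delta>\<^sup>2\<close> and \<open>Y = \<eta>\<^sup>2 - (1 - \<tau>)\<^sup>2 \<delta>\<^sup>2\<close>,
  every consistent \<open>c + h\<close> therefore satisfies
  \<open>l \<parallel>h\<parallel>\<^sup>2 \<le> \<langle>T h, h\<rangle> \<le> (1 - \<tau>) X + \<tau> Y\<close>.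

  The equation for \<open>\<tau>\<close> makes this bound attained, at \<open>h\<close> and at \<open>- h\<close>. An eigenvector \<open>h\<close>
  of \<open>T\<close> for \<open>l\<close> is orthogonal to \<open>ran R \<inter> ran S\<close>, where \<open>T\<close> is the
  identity, and the ratio of \<open>\<parallel>R h\<parallel>\<^sup>2\<close> to \<open>\<parallel>S h\<parallel>\<^sup>2\<close> is a function
  of \<open>\<tau>\<close> and \<open>l\<close> (\<open>eigenvector_energy_split\<close>). After clearing the denominator, the
  equation states that this ratio is \<open>X : Y\<close>. So \<open>h\<close> can be scaled to have
  \<open>\<parallel>R h\<parallel>\<^sup>2 = X\<close> and \<open>\<parallel>S h\<parallel>\<^sup>2 = Y\<close> (\<open>extremal_displacement\<close>); then both
  \<open>c + h\<close> and \<open>c - h\<close> are consistent and no consistent point is farther from \<open>c\<close>.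
  A point with this property is the only Chebyshev center
  (\<open>chebyshev_center_unique_if_diameter\<close>).

  Three points need care. The scaling needs \<open>X, Y \<ge> 0\<close>, which follows
  from \<open>\<delta> \<le> \<epsilon> + \<eta>\<close> except at \<open>\<tau> = 1/2\<close>, where it is the extra
  hypothesis (\<open>balanced_residuals_feasible\<close>). If \<open>l = 1/2\<close>, the ratio is not determined by
  \<open>l\<close>, but suitable vectors from the two kernels can be added instead
  (\<open>extremal_displacement_half\<close>). If \<open>\<tau> = 1\<close>, then \<open>\<eta> = 0\<close>, and the consistent set
  is symmetric about the constrained minimizer (\<open>chebyshev_center_exact_iff\<close>).
\<close>

section \<open>Chebyshev centers from antipodal farthest points\<close>

text \<open>
  By the parallelogram law, of two points at distance \<open>\<parallel>h\<parallel>\<close> on opposite sides of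
  \<open>c\<close>, one has squared distance at least \<open>\<parallel>h\<parallel>\<^sup>2 + \<parallel>c - x\<parallel>\<^sup>2\<close> from \<open>x\<close>. So
  moving the center away from \<open>c\<close> strictly increases the radius.
\<close>

lemma chebyshev_center_unique_if_diameter:
  fixes c h :: "'a::real_inner"
  assumes sub: "\<And>f. f \<in> C \<Longrightarrow> norm (f - c) \<le> norm h"
    and plus: "c + h \<in> C" and minus: "c - h \<in> C"
  shows "chebyshev_center C g \<longleftrightarrow> g = c"
proof -
  have bdd: "bounded C"
    unfolding bounded_any_center[where a = c] using sub by (auto simp: dist_norm norm_minus_commute)
  have bdd_above: "bdd_above ((\<lambda>f. norm (f - x)) ` C)" for x
    using bdd unfolding bounded_any_center[where a = x]
    by (auto simp: bdd_above_def dist_norm norm_minus_commute)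
  have radius_c: "(SUP f\<in>C. norm (f - c)) = norm h"
  proof (rule antisym)
    show "(SUP f\<in>C. norm (f - c)) \<le> norm h"
      using sub plus by (intro cSUP_least) auto
    show "norm h \<le> (SUP f\<in>C. norm (f - c))"
      using cSUP_upper[OF plus bdd_above[of c]] by simp
  qed
  have radius: "(norm h)\<^sup>2 + (norm (c - x))\<^sup>2 \<le> (SUP f\<in>C. norm (f - x))\<^sup>2" for x
  proof -
    have "(norm (c + h - x))\<^sup>2 \<le> (SUP f\<in>C. norm (f - x))\<^sup>2"
      and "(norm (c - h - x))\<^sup>2 \<le> (SUP f\<in>C. norm (f - x))\<^sup>2"
      using cSUP_upper[OF plus bdd_above[of x]] cSUP_upper[OF minus bdd_above[of x]]
      by (auto intro: power_mono)
    moreover have "(norm (c + h - x))\<^sup>2 + (norm (c - h - x))\<^sup>2 = 2 * (norm h)\<^sup>2 + 2 * (norm (c - x))\<^sup>2"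
      by (simp add: power2_norm_eq_inner inner_diff_left inner_diff_right inner_add_left
          inner_add_right inner_commute algebra_simps)
    ultimately show ?thesis by linarith
  qed
  have sup_nonneg: "0 \<le> (SUP f\<in>C. norm (f - x))" for x
    using cSUP_upper[OF plus bdd_above[of x]] norm_ge_zero order_trans by blast
  show ?thesis
  proof
    assume "chebyshev_center C g"
    then have "(SUP f\<in>C. norm (f - g)) \<le> norm h"
      unfolding chebyshev_center_def radius_c[symmetric] by blast
    then have "(SUP f\<in>C. norm (f - g))\<^sup>2 \<le> (norm h)\<^sup>2"
      using sup_nonneg[of g] by (intro power_mono) auto
    with radius[of g] have "(norm (c - g))\<^sup>2 \<le> 0" by linarith
    then show "g = c" by simp
  next
    assume "g = c"
    have "norm h \<le> (SUP f\<in>C. norm (f - x))" for x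
    proof (rule power2_le_imp_le[OF _ sup_nonneg])
      show "(norm h)\<^sup>2 \<le> (SUP f\<in>C. norm (f - x))\<^sup>2"
        using radius[of x] zero_le_power2[of "norm (c - x)"] by linarith
    qed
    then show "chebyshev_center C g"
      using bdd plus radius_c \<open>g = c\<close> by (auto simp: chebyshev_center_def)
  qed
qed

text \<open>A farthest point from \<open>c\<close> and its mirror image are an antipodal pair.\<close>

lemma chebyshev_center_unique_if_symmetric:
  fixes c :: "'a::real_inner"
  assumes "compact C" and "C \<noteq> {}" and sym: "\<And>f. f \<in> C \<Longrightarrow> 2 *\<^sub>R c - f \<in> C"
  shows "chebyshev_center C g \<longleftrightarrow> g = c"
proof -
  have "continuous_on C (\<lambda>f. norm (f - c))" by (intro continuous_intros)
  from continuous_attains_sup[OF assms(1,2) this] obtain x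
    where x: "x \<in> C" and far: "\<And>f. f \<in> C \<Longrightarrow> norm (f - c) \<le> norm (x - c)"
    by blast
  have "c - (x - c) \<in> C" using sym[OF x] by (simp add: scaleR_2 algebra_simps)
  with x show ?thesis
    by (intro chebyshev_center_unique_if_diameter[where h = "x - c"] far) auto
qed

section \<open>The smallest eigenvalue of a self-adjoint operator\<close>

text \<open>
  The minimum of the quadratic form on the unit sphere is attained, and by first-order
  optimality a minimizer is an eigenvector. Every eigenvalue is a value of the form on the
  sphere, so the minimum is the least eigenvalue.
\<close>

lemma
  fixes T :: "'a::euclidean_space \<Rightarrow> 'a"
  assumes "linear T" and adj: "\<And>x y. T x \<bullet> y = x \<bullet> T y"
  shows eigenvalue_lambda_min: "eigenvalue T (lambda_min T)"
    and lambda_min_le_form: "lambda_min T * (norm x)\<^sup>2 \<le> T x \<bullet> x"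
proof -
  interpret T: linear T by fact
  have "continuous_on (sphere 0 1) (\<lambda>x. T x \<bullet> x)"
    using linear_continuous_on[OF linear_conv_bounded_linear[THEN iffD1, OF \<open>linear T\<close>]]
    by (intro continuous_intros)
  moreover have "sphere (0::'a) 1 \<noteq> {}" using vector_choose_size[of 1] by auto
  ultimately obtain e :: 'a where e: "norm e = 1"
    and min: "\<And>x. norm x = 1 \<Longrightarrow> T e \<bullet> e \<le> T x \<bullet> x"
    using continuous_attains_inf[OF compact_sphere, of 0 1 "\<lambda>x. T x \<bullet> x"] by auto
  define m where "m = T e \<bullet> e"
  have form: "m * (norm x)\<^sup>2 \<le> T x \<bullet> x" for x
  proof (cases "x = 0")
    case True
    then show ?thesis by (simp add: T.zero)
  next
    case False
    with min[of "x /\<^sub>R norm x"] have "m \<le> T x \<bullet> x / (norm x)\<^sup>2"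
      by (simp add: m_def T.scaleR power2_eq_square divide_inverse mult_ac)
    with False show ?thesis by (simp add: field_simps)
  qed
  define q where "q = T e - m *\<^sub>R e"
  have "q = 0"
  proof (rule ccontr)
    assume "q \<noteq> 0"
    define K where "K = T q \<bullet> q - m * (norm q)\<^sup>2"
    have quad: "0 \<le> 2 * t * (norm q)\<^sup>2 + t\<^sup>2 * K" for t
    proof -
      have "T (e + t *\<^sub>R q) \<bullet> (e + t *\<^sub>R q) - m * (norm (e + t *\<^sub>R q))\<^sup>2
        = (T e \<bullet> e - m * (norm e)\<^sup>2) + 2 * t * (T e \<bullet> q - m * (e \<bullet> q)) + t\<^sup>2 * K"
        using adj[of q e]
        unfolding K_def power2_norm_eq_inner
        by (simp add: T.add T.scaleR inner_add_left inner_add_right inner_commute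
            power2_eq_square ring_distribs)
      also have "T e \<bullet> q - m * (e \<bullet> q) = (norm q)\<^sup>2"
        by (simp add: q_def power2_norm_eq_inner inner_diff_left inner_diff_right algebra_simps)
      finally show ?thesis using form[of "e + t *\<^sub>R q"] e by (simp add: m_def)
    qed
    have "K \<ge> 0" using form[of q] by (simp add: K_def)
    \<comment> \<open>Moving from \<open>e\<close> along \<open>- q\<close> lowers the form; the step \<open>N / (K + 1)\<close> is small enough
      for the linear term to dominate.\<close>
    define N where "N = (norm q)\<^sup>2"
    have "N > 0" using \<open>q \<noteq> 0\<close> by (simp add: N_def)
    have "0 \<le> (K + 1)\<^sup>2 * (2 * (- N / (K + 1)) * N + (- N / (K + 1))\<^sup>2 * K)"
      using quad[of "- N / (K + 1)"] by (simp add: N_def)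
    also have "\<dots> = - (N\<^sup>2 * (K + 2))"
      using \<open>K \<ge> 0\<close> by (simp add: power2_eq_square divide_simps) (simp add: algebra_simps)
    finally have "N\<^sup>2 * (K + 2) \<le> 0" by simp
    moreover have "N\<^sup>2 * (K + 2) > 0" using \<open>N > 0\<close> \<open>K \<ge> 0\<close> by simp
    ultimately show False by simp
  qed
  then have eig: "eigenvalue T m"
    unfolding eigenvalue_def q_def using e by (intro exI[of _ e]) auto
  moreover have "m \<le> l" if "eigenvalue T l" for l
  proof -
    from that obtain v where "v \<noteq> 0" "T v = l *\<^sub>R v" by (auto simp: eigenvalue_def)
    with form[of v] show ?thesis by (simp add: power2_norm_eq_inner)
  qed
  ultimately have "lambda_min T = m"
    unfolding lambda_min_def by (intro Least_equality)
  with eig form show "eigenvalue T (lambda_min T)" "lambda_min T * (norm x)\<^sup>2 \<le> T x \<bullet> x"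
    by auto
qed

section \<open>Two orthogonal projectors with trivially intersecting kernels\<close>

lemma norm_plus_square:
  fixes x y :: "'a::real_inner"
  shows "(norm (x + y))\<^sup>2 = (norm x)\<^sup>2 + 2 * (x \<bullet> y) + (norm y)\<^sup>2"
  by (simp add: power2_norm_eq_inner inner_add_left inner_add_right inner_commute)

lemma norm_minus_square:
  fixes x y :: "'a::real_inner"
  shows "(norm (x - y))\<^sup>2 = (norm x)\<^sup>2 - 2 * (x \<bullet> y) + (norm y)\<^sup>2"
  by (simp add: power2_norm_eq_inner inner_diff_left inner_diff_right inner_commute)

lemma projector_inner_self:
  assumes "orthogonal_projector P"
  shows "P x \<bullet> x = (norm (P x))\<^sup>2"
  using assms by (metis orthogonal_projector_def power2_norm_eq_inner)

lemma projector_norm_le: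
  assumes "orthogonal_projector P"
  shows "norm (P x) \<le> norm x"
proof -
  have "(norm (P x))\<^sup>2 \<le> norm (P x) * norm x"
    using projector_inner_self[OF assms, of x] norm_cauchy_schwarz[of "P x" x] by simp
  then show ?thesis
    by (metis mult_left_le_imp_le norm_ge_zero norm_zero power2_eq_square zero_less_norm_iff order_le_less)
qed

lemma projector_kernel_nontrivial:
  assumes "orthogonal_projector P" and "P \<noteq> id"
  obtains k where "k \<noteq> 0" "P k = 0"
proof -
  from \<open>P \<noteq> id\<close> obtain x where "P x \<noteq> x" by (auto simp: fun_eq_iff)
  moreover have "P (x - P x) = 0"
    using assms(1) by (simp add: orthogonal_projector_def linear_diff)
  ultimately show thesis by (intro that[of "x - P x"]) auto
qed

locale transversal_projectors =
  fixes R S :: "'a::euclidean_space \<Rightarrow> 'a"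
  assumes R: "orthogonal_projector R" and S: "orthogonal_projector S"
    and transversal: "R x = 0 \<Longrightarrow> S x = 0 \<Longrightarrow> x = 0"
begin

sublocale R: linear R using R by (simp add: orthogonal_projector_def)
sublocale S: linear S using S by (simp add: orthogonal_projector_def)

lemma R_idem: "R (R x) = R x" and R_adj: "R x \<bullet> y = x \<bullet> R y"
  and S_idem: "S (S x) = S x" and S_adj: "S x \<bullet> y = x \<bullet> S y"
  using R S by (auto simp: orthogonal_projector_def)

definition mix :: "real \<Rightarrow> 'a \<Rightarrow> 'a" where
  "mix \<tau> = (\<lambda>f. (1 - \<tau>) *\<^sub>R R f + \<tau> *\<^sub>R S f)"

lemma linear_mix: "linear (mix \<tau>)"
  unfolding mix_def by (intro linearI) (simp_all add: R.add S.add R.scaleR S.scaleR algebra_simps)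

lemma mix_adj: "mix \<tau> x \<bullet> y = x \<bullet> mix \<tau> y"
  by (simp add: mix_def inner_add_left inner_add_right R_adj S_adj)

lemma mix_form: "mix \<tau> x \<bullet> x = (1 - \<tau>) * (norm (R x))\<^sup>2 + \<tau> * (norm (S x))\<^sup>2"
  by (simp add: mix_def inner_add_left projector_inner_self[OF R] projector_inner_self[OF S])

lemma mix_form_pos:
  assumes "0 < \<tau>" "\<tau> < 1" "x \<noteq> 0"
  shows "0 < mix \<tau> x \<bullet> x"
proof -
  have "R x \<noteq> 0 \<or> S x \<noteq> 0" using transversal \<open>x \<noteq> 0\<close> by blast
  then show ?thesis
    unfolding mix_form using assms by (auto intro: add_pos_nonneg add_nonneg_pos)
qed

abbreviation lam :: "real \<Rightarrow> real" where "lam \<tau> \<equiv> lambda_min (mix \<tau>)"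

lemma lam_le_form: "lam \<tau> * (norm x)\<^sup>2 \<le> (1 - \<tau>) * (norm (R x))\<^sup>2 + \<tau> * (norm (S x))\<^sup>2"
  using lambda_min_le_form[OF linear_mix mix_adj, of \<tau> x] by (simp add: mix_form)

lemma lam_eigenvector: obtains e where "norm e = 1" "mix \<tau> e = lam \<tau> *\<^sub>R e"
proof -
  interpret M: linear "mix \<tau>" by (rule linear_mix)
  obtain v where "v \<noteq> 0" "mix \<tau> v = lam \<tau> *\<^sub>R v"
    using eigenvalue_lambda_min[OF linear_mix mix_adj, of \<tau>] by (auto simp: eigenvalue_def)
  then show thesis by (intro that[of "v /\<^sub>R norm v"]) (simp_all add: M.scaleR mult.commute)
qed

lemma lam_pos:
  assumes "0 < \<tau>" "\<tau> < 1"
  shows "0 < lam \<tau>"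
proof -
  obtain e where e: "norm e = 1" "mix \<tau> e = lam \<tau> *\<^sub>R e" by (rule lam_eigenvector)
  then show ?thesis
    using mix_form_pos[OF assms, of e] by (cases "e = 0") (auto simp: dot_square_norm)
qed

text \<open>Test the quadratic form on a kernel vector of \<open>R\<close>, respectively of \<open>S\<close>.\<close>

lemma lam_le:
  assumes "0 < \<tau>" "\<tau> < 1" "R \<noteq> id" "S \<noteq> id"
  shows "lam \<tau> \<le> \<tau>" and "lam \<tau> \<le> 1 - \<tau>"
proof -
  have sq_le: "(norm (P x))\<^sup>2 \<le> (norm x)\<^sup>2" if "orthogonal_projector P" for P and x :: 'a
    using projector_norm_le[OF that] by (simp add: power_mono)
  obtain k where k: "k \<noteq> 0" "R k = 0" using projector_kernel_nontrivial[OF R \<open>R \<noteq> id\<close>] .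
  have "lam \<tau> * (norm k)\<^sup>2 \<le> \<tau> * (norm (S k))\<^sup>2"
    using lam_le_form[of \<tau> k] k by simp
  also have "\<dots> \<le> \<tau> * (norm k)\<^sup>2" using sq_le[OF S] assms(1) by (intro mult_left_mono) auto
  finally show "lam \<tau> \<le> \<tau>" using k by simp
  obtain k where k: "k \<noteq> 0" "S k = 0" using projector_kernel_nontrivial[OF S \<open>S \<noteq> id\<close>] .
  have "lam \<tau> * (norm k)\<^sup>2 \<le> (1 - \<tau>) * (norm (R k))\<^sup>2"
    using lam_le_form[of \<tau> k] k by simp
  also have "\<dots> \<le> (1 - \<tau>) * (norm k)\<^sup>2" using sq_le[OF R] assms(2) by (intro mult_left_mono) auto
  finally show "lam \<tau> \<le> 1 - \<tau>" using k by simp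
qed

text \<open>
  Pairing \<open>T e = l e\<close> with \<open>R e\<close> and with \<open>S e\<close> gives two equations that both contain
  \<open>\<langle>R e, S e\<rangle>\<close>. Eliminating it leaves one relation between the energies
  \<open>\<parallel>R e\<parallel>\<^sup>2\<close> and \<open>\<parallel>S e\<parallel>\<^sup>2\<close>; the quadratic form at \<open>e\<close> is the second one.
  The factor \<open>1 - 2 l\<close> is the determinant of this linear system in the weighted energies
  \<open>A\<close> and \<open>B\<close>.
\<close>

lemma eigenvector_energy_split:
  assumes e: "norm e = 1" "mix \<tau> e = l *\<^sub>R e"
  shows "(1 - \<tau>) * (1 - 2 * l) * (norm (R e))\<^sup>2 = l * (\<tau> - l)"
    and "\<tau> * (1 - 2 * l) * (norm (S e))\<^sup>2 = l * (1 - \<tau> - l)"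
proof -
  define A B where "A = (1 - \<tau>) * (norm (R e))\<^sup>2" and "B = \<tau> * (norm (S e))\<^sup>2"
  have AB: "A + B = l"
    using mix_form[of \<tau> e] e by (simp add: A_def B_def dot_square_norm)
  have "mix \<tau> e \<bullet> R e = (1 - \<tau>) * (norm (R e))\<^sup>2 + \<tau> * (R e \<bullet> S e)"
    by (simp add: mix_def inner_add_left dot_square_norm inner_commute[of "S e"])
  moreover have "mix \<tau> e \<bullet> S e = (1 - \<tau>) * (R e \<bullet> S e) + \<tau> * (norm (S e))\<^sup>2"
    by (simp add: mix_def inner_add_left dot_square_norm)
  moreover have "mix \<tau> e \<bullet> R e = l * (norm (R e))\<^sup>2" "mix \<tau> e \<bullet> S e = l * (norm (S e))\<^sup>2"
    using e by (simp_all add: projector_inner_self[OF R] projector_inner_self[OF S] inner_commute[of e])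
  ultimately have tg: "\<tau> * (R e \<bullet> S e) = (l - 1 + \<tau>) * (norm (R e))\<^sup>2"
    and gt: "(1 - \<tau>) * (R e \<bullet> S e) = (l - \<tau>) * (norm (S e))\<^sup>2"
    by (simp_all add: algebra_simps)
  have "(l - 1 + \<tau>) * A = (1 - \<tau>) * (\<tau> * (R e \<bullet> S e))"
    unfolding tg A_def by (simp add: mult_ac)
  also have "\<dots> = \<tau> * ((1 - \<tau>) * (R e \<bullet> S e))" by (simp only: mult_ac)
  also have "\<dots> = (l - \<tau>) * B"
    unfolding gt B_def by (simp add: mult_ac)
  finally have *: "(l - 1 + \<tau>) * A = (l - \<tau>) * B" .
  have "(1 - 2 * l) * A = l * (\<tau> - l)" "(1 - 2 * l) * B = l * (1 - \<tau> - l)"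
    using * unfolding AB[symmetric] by algebra+
  then show "(1 - \<tau>) * (1 - 2 * l) * (norm (R e))\<^sup>2 = l * (\<tau> - l)"
    and "\<tau> * (1 - 2 * l) * (norm (S e))\<^sup>2 = l * (1 - \<tau> - l)"
    by (simp_all add: A_def B_def mult_ac)
qed

text \<open>
  If the smallest eigenvalue of \<open>(R + S) / 2\<close> is \<open>1/2\<close>, every vector in the kernel of one
  projector is fixed by the other one. A sum of suitably scaled kernel vectors then has any
  prescribed energies under \<open>R\<close> and \<open>S\<close>.
\<close>

lemma extremal_displacement_half:
  assumes half: "lam (1/2) = 1/2" and "R \<noteq> id" "S \<noteq> id" and "0 \<le> X" "0 \<le> Y"
  obtains h where "(norm (R h))\<^sup>2 = X" "(norm (S h))\<^sup>2 = Y" "(norm h)\<^sup>2 = X + Y"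
    and "\<And>d. R d = d \<Longrightarrow> S d = d \<Longrightarrow> h \<bullet> d = 0"
proof -
  have fix_if_full: "P x = x" if "orthogonal_projector P" "(norm x)\<^sup>2 \<le> (norm (P x))\<^sup>2" for P and x :: 'a
  proof -
    have "(norm (x - P x))\<^sup>2 = (norm x)\<^sup>2 - (norm (P x))\<^sup>2"
      using projector_inner_self[OF that(1), of x]
      by (simp add: norm_minus_square inner_commute)
    with that(2) have "(norm (x - P x))\<^sup>2 \<le> 0" by simp
    then show ?thesis by simp
  qed
  obtain k where k: "k \<noteq> 0" "R k = 0" using projector_kernel_nontrivial[OF R \<open>R \<noteq> id\<close>] .
  obtain k' where k': "k' \<noteq> 0" "S k' = 0" using projector_kernel_nontrivial[OF S \<open>S \<noteq> id\<close>] .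
  have Sk: "S k = k" and Rk': "R k' = k'"
    using lam_le_form[of "1/2" k] lam_le_form[of "1/2" k'] k k' half
    by (auto intro!: fix_if_full R S)
  have orth: "k \<bullet> k' = 0" using R_adj[of k k'] k Rk' by simp
  define u u' where "u = (sqrt Y / norm k) *\<^sub>R k" and "u' = (sqrt X / norm k') *\<^sub>R k'"
  have norms: "(norm u)\<^sup>2 = Y" "(norm u')\<^sup>2 = X"
    using assms k k' by (simp_all add: u_def u'_def)
  have R_h: "R (u + u') = u'" and S_h: "S (u + u') = u"
    using k k' Sk Rk' by (simp_all add: u_def u'_def R.add S.add R.scaleR S.scaleR)
  show thesis
  proof (rule that[of "u + u'"])
    have "u \<bullet> u' = 0" by (simp add: u_def u'_def orth)
    then show "(norm (u + u'))\<^sup>2 = X + Y" by (simp add: norm_add_Pythagorean norms orthogonal_def)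
    show "(u + u') \<bullet> d = 0" if "R d = d" "S d = d" for d
      using R_adj[of k d] S_adj[of k' d] that k k' by (simp add: u_def u'_def inner_add_left)
  qed (simp_all add: R_h S_h norms)
qed

text \<open>
  The hypothesis \<open>balance\<close> is the proportion \<open>X : Y\<close> that \<open>eigenvector_energy_split\<close>
  gives for the energies of an eigenvector. It is written as a product because each of
  \<open>\<tau>\<close> and \<open>1 - \<tau>\<close> can itself be the smallest eigenvalue; if exactly one of them
  is, one of the energies is zero.
\<close>

lemma extremal_displacement:
  assumes \<tau>: "0 < \<tau>" "\<tau> < 1" and "R \<noteq> id" "S \<noteq> id" and XY: "0 \<le> X" "0 \<le> Y"
    and balance: "(1 - \<tau>) * (1 - \<tau> - lam \<tau>) * X = \<tau> * (\<tau> - lam \<tau>) * Y"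
  obtains h where "(norm (R h))\<^sup>2 = X" "(norm (S h))\<^sup>2 = Y"
    and "lam \<tau> * (norm h)\<^sup>2 = (1 - \<tau>) * X + \<tau> * Y"
    and "\<And>d. R d = d \<Longrightarrow> S d = d \<Longrightarrow> h \<bullet> d = 0"
proof (cases "lam \<tau> = 1/2")
  case True
  with lam_le[OF \<tau> assms(3,4)] have \<tau>_half: "\<tau> = 1/2" by simp
  show thesis
  proof (rule extremal_displacement_half[OF True[unfolded \<tau>_half] assms(3,4) XY])
    fix h
    assume h: "(norm (R h))\<^sup>2 = X" "(norm (S h))\<^sup>2 = Y" "(norm h)\<^sup>2 = X + Y"
      and orth: "\<And>d. R d = d \<Longrightarrow> S d = d \<Longrightarrow> h \<bullet> d = 0"
    have "lam \<tau> * (norm h)\<^sup>2 = (1 - \<tau>) * X + \<tau> * Y"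
      unfolding \<tau>_half True[unfolded \<tau>_half] h(3) by (simp add: add_divide_distrib)
    with h(1,2) show thesis using orth by (rule that)
  qed
next
  case False
  note le = lam_le[OF \<tau> assms(3,4)] and pos = lam_pos[OF \<tau>]
  define l where "l = lam \<tau>"
  have l: "0 < l" "l \<noteq> 1/2" "l < 1" using False pos le \<tau> by (auto simp: l_def)
  obtain e where e: "norm e = 1" "mix \<tau> e = l *\<^sub>R e" unfolding l_def by (rule lam_eigenvector)
  note split = eigenvector_energy_split[OF e]
  define N where "N = ((1 - \<tau>) * X + \<tau> * Y) / l"
  have lN: "l * N = (1 - \<tau>) * X + \<tau> * Y" using l by (simp add: N_def)
  have "N \<ge> 0" using l XY \<tau> by (simp add: N_def)
  define h where "h = sqrt N *\<^sub>R e"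
  have bal: "(1 - \<tau>) * (1 - \<tau> - l) * X = \<tau> * (\<tau> - l) * Y" using balance by (simp add: l_def)
  have "(1 - \<tau>) * (1 - 2 * l) * (N * (norm (R e))\<^sup>2) = (1 - \<tau>) * (1 - 2 * l) * X"
    using split(1) lN bal by algebra
  then have RX: "N * (norm (R e))\<^sup>2 = X" using \<tau> l by simp
  have "\<tau> * (1 - 2 * l) * (N * (norm (S e))\<^sup>2) = \<tau> * (1 - 2 * l) * Y"
    using split(2) lN bal by algebra
  then have SY: "N * (norm (S e))\<^sup>2 = Y" using \<tau> l by simp
  show thesis
  proof (rule that[of h])
    show "(norm (R h))\<^sup>2 = X" "(norm (S h))\<^sup>2 = Y"
      using RX SY \<open>N \<ge> 0\<close> by (simp_all add: h_def R.scaleR S.scaleR power_mult_distrib)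
    show "lam \<tau> * (norm h)\<^sup>2 = (1 - \<tau>) * X + \<tau> * Y"
      using lN \<open>N \<ge> 0\<close> e by (simp add: h_def l_def power_mult_distrib)
    show "h \<bullet> d = 0" if "R d = d" "S d = d" for d
    proof -
      have "mix \<tau> d = d" using that by (simp add: mix_def scaleR_left_distrib[symmetric])
      with mix_adj[of \<tau> e d] e have "l * (e \<bullet> d) = e \<bullet> d" by simp
      with l show ?thesis by (simp add: h_def)
    qed
  qed
qed

text \<open>
  The vector \<open>c\<close> that solves the normal equation for equal weights has opposite residuals
  \<open>R c - r\<close> and \<open>S c - s\<close>. Hence they lie in both ranges, and \<open>d\<close> is twice the
  first one. Walking along \<open>d\<close> shifts both residuals by multiples of \<open>d\<close>; half a step
  back from \<open>c\<close> the first one vanishes.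
\<close>

lemma regularization_path_exists:
  assumes "r \<in> range R" "s \<in> range S"
  obtains f\<^sub>0 d where "R d = d" "S d = d" "R f\<^sub>0 = r" "S f\<^sub>0 = s - d"
proof -
  interpret M: linear "mix (1/2)" by (rule linear_mix)
  have fixed: "R r = r" "S s = s" using assms R_idem S_idem by auto
  \<comment> \<open>A positive definite operator is injective, hence onto in finite dimension.\<close>
  have "inj (mix (1/2))"
    using mix_form_pos[of "1/2"] by (force simp: M.inj_iff_eq_0)
  then have "surj (mix (1/2))" by (rule linear_inj_imp_surj[OF linear_mix])
  then obtain c where "mix (1/2) c = (1/2) *\<^sub>R (r + s)" by (metis surjD)
  then have "(1/2) *\<^sub>R (R c + S c) = (1/2) *\<^sub>R (r + s)" by (simp add: mix_def scaleR_right_distrib)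
  then have eq: "R c + S c = r + s" by simp
  define d where "d = 2 *\<^sub>R (R c - r)"
  have d': "d = 2 *\<^sub>R (s - S c)"
    unfolding d_def using eq by (metis add_diff_cancel_left' diff_add_eq diff_diff_eq2)
  have "R d = d" by (simp add: d_def R.scaleR R.diff R_idem fixed)
  moreover have "S d = d" by (simp add: d' S.scaleR S.diff S_idem fixed)
  moreover have "R (c - (1/2) *\<^sub>R d) = r"
    using \<open>R d = d\<close> by (simp add: R.diff R.scaleR) (simp add: d_def)
  moreover have "S (c - (1/2) *\<^sub>R d) = s - d"
  proof -
    have "S c = s - (1/2) *\<^sub>R d" by (simp add: d')
    then have "S (c - (1/2) *\<^sub>R d) = s - ((1/2) *\<^sub>R d + (1/2) *\<^sub>R d)"
      using \<open>S d = d\<close> by (simp only: S.diff S.scaleR diff_diff_eq)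
    then show ?thesis by (simp only: scaleR_left_distrib[symmetric]) simp
  qed
  ultimately show thesis by (rule that)
qed

end

section \<open>The regularization path\<close>

locale regularization_path = transversal_projectors +
  fixes r s f\<^sub>0 d :: 'a
  assumes Rd: "R d = d" and Sd: "S d = d" and R_start: "R f\<^sub>0 = r" and S_start: "S f\<^sub>0 = s - d"
begin

definition tikhonov :: "real \<Rightarrow> 'a" where "tikhonov \<tau> = f\<^sub>0 + \<tau> *\<^sub>R d"

lemma residual_R:
  "(norm (R (tikhonov \<tau> + h) - r))\<^sup>2 = \<tau>\<^sup>2 * (norm d)\<^sup>2 + 2 * \<tau> * (h \<bullet> d) + (norm (R h))\<^sup>2"
proof -
  have "R (tikhonov \<tau> + h) - r = \<tau> *\<^sub>R d + R h"
    by (simp add: tikhonov_def R.add R.scaleR Rd R_start)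
  moreover have "R h \<bullet> d = h \<bullet> d" using R_adj[of h d] Rd by simp
  ultimately show ?thesis
    by (simp add: norm_plus_square power_mult_distrib inner_commute)
qed

lemma residual_S:
  "(norm (S (tikhonov \<tau> + h) - s))\<^sup>2
    = (1 - \<tau>)\<^sup>2 * (norm d)\<^sup>2 - 2 * (1 - \<tau>) * (h \<bullet> d) + (norm (S h))\<^sup>2"
proof -
  have "S (tikhonov \<tau> + h) - s = S h - (1 - \<tau>) *\<^sub>R d"
    by (simp add: tikhonov_def S.add S.scaleR Sd S_start algebra_simps)
  moreover have "S h \<bullet> d = h \<bullet> d" using S_adj[of h d] Sd by simp
  ultimately show ?thesis
    by (simp add: norm_minus_square power_mult_distrib)
qed

text \<open>
  The weights are those for which the terms linear in \<open>h\<close> cancel: this is the stationarity of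
  the objective at \<open>tikhonov \<tau>\<close>.
\<close>

lemma weighted_residual:
  "(1 - \<tau>) * (norm (R (tikhonov \<tau> + h) - r))\<^sup>2 + \<tau> * (norm (S (tikhonov \<tau> + h) - s))\<^sup>2
    = \<tau> * (1 - \<tau>) * (norm d)\<^sup>2 + ((1 - \<tau>) * (norm (R h))\<^sup>2 + \<tau> * (norm (S h))\<^sup>2)"
  unfolding residual_R residual_S by (simp add: algebra_simps power2_eq_square)

text \<open>
  On \<open>S f = s\<close> the displacement from \<open>tikhonov 1\<close> lies in \<open>ker S\<close>, hence is
  orthogonal to \<open>d = S d\<close>, and Pythagoras applies.
\<close>

lemma residual_R_data:
  assumes "S f = s"
  shows "(norm (R f - r))\<^sup>2 = (norm d)\<^sup>2 + (norm (R (f - tikhonov 1)))\<^sup>2"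
proof -
  have "S (f - tikhonov 1) = 0" using assms by (simp add: S.diff tikhonov_def S.add Sd S_start)
  then have "(f - tikhonov 1) \<bullet> d = 0" using S_adj[of "f - tikhonov 1" d] Sd by simp
  with residual_R[of 1 "f - tikhonov 1"] show ?thesis by simp
qed

lemma residual_S_data:
  assumes "R f = r"
  shows "(norm (S f - s))\<^sup>2 = (norm d)\<^sup>2 + (norm (S (f - tikhonov 0)))\<^sup>2"
proof -
  have "R (f - tikhonov 0) = 0" using assms by (simp add: R.diff tikhonov_def R_start)
  then have "(f - tikhonov 0) \<bullet> d = 0" using R_adj[of "f - tikhonov 0" d] Rd by simp
  with residual_S[of 0 "f - tikhonov 0"] show ?thesis by simp
qed

lemma S_tikhonov_1: "S (tikhonov 1) = s"
  by (simp add: tikhonov_def S.add Sd S_start)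

lemma is_minimum_R: "is_minimum {norm (R f - r) | f. S f = s} (norm d)"
  unfolding is_minimum_def
proof (intro conjI ballI)
  have "R (tikhonov 1) - r = d" by (simp add: tikhonov_def R.add Rd R_start)
  with S_tikhonov_1 show "norm d \<in> {norm (R f - r) | f. S f = s}" by (auto intro!: exI[of _ "tikhonov 1"])
  show "norm d \<le> a" if "a \<in> {norm (R f - r) | f. S f = s}" for a
    using that residual_R_data by (force intro: power2_le_imp_le)
qed

lemma is_minimum_S: "is_minimum {norm (S f - s) | f. R f = r} (norm d)"
  unfolding is_minimum_def
proof (intro conjI ballI)
  have "S (tikhonov 0) - s = - d" by (simp add: tikhonov_def S_start)
  then have "norm (S (tikhonov 0) - s) = norm d" by simp
  moreover have "R (tikhonov 0) = r" by (simp add: tikhonov_def R_start)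
  ultimately show "norm d \<in> {norm (S f - s) | f. R f = r}" by (auto intro!: exI[of _ "tikhonov 0"])
  show "norm d \<le> a" if "a \<in> {norm (S f - s) | f. R f = r}" for a
    using that residual_S_data by (force intro: power2_le_imp_le)
qed

lemma regularization_solution_iff:
  assumes "0 < \<tau>" "\<tau> \<le> 1"
  shows "regularization_solution R S r s \<tau> f \<longleftrightarrow> f = tikhonov \<tau>"
proof (cases "\<tau> = 1")
  case True
  have ge: "norm d \<le> norm (R g - r)" if "S g = s" for g
    using is_minimum_R that by (auto simp: is_minimum_def)
  have at: "norm (R (tikhonov 1) - r) = norm d"
    by (simp add: tikhonov_def R.add Rd R_start)
  have uniq: "g = tikhonov 1" if "S g = s" "norm (R g - r) \<le> norm d" for g
  proof -
    have "(norm (R g - r))\<^sup>2 \<le> (norm d)\<^sup>2" using that by (simp add: power_mono)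
    with residual_R_data[OF \<open>S g = s\<close>] have "R (g - tikhonov 1) = 0" by simp
    moreover have "S (g - tikhonov 1) = 0" using that S_tikhonov_1 by (simp add: S.diff)
    ultimately show ?thesis using transversal by force
  qed
  have "is_arg_min (\<lambda>g. norm (R g - r)) (\<lambda>g. S g = s) f \<longleftrightarrow> f = tikhonov 1"
  proof
    assume "is_arg_min (\<lambda>g. norm (R g - r)) (\<lambda>g. S g = s) f"
    then have "S f = s" "norm (R f - r) \<le> norm (R (tikhonov 1) - r)"
      using S_tikhonov_1 by (auto simp only: is_arg_min_linorder)
    then show "f = tikhonov 1" unfolding at by (rule uniq)
  next
    assume "f = tikhonov 1"
    then show "is_arg_min (\<lambda>g. norm (R g - r)) (\<lambda>g. S g = s) f"
      using ge by (simp add: is_arg_min_linorder S_tikhonov_1 at)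
  qed
  then show ?thesis using True by (simp add: regularization_solution_def)
next
  case False
  define J where "J g = (1 - \<tau>) * (norm (R g - r))\<^sup>2 + \<tau> * (norm (S g - s))\<^sup>2" for g
  have J: "J g = \<tau> * (1 - \<tau>) * (norm d)\<^sup>2 + mix \<tau> (g - tikhonov \<tau>) \<bullet> (g - tikhonov \<tau>)" for g
    using weighted_residual[of \<tau> "g - tikhonov \<tau>"] by (simp add: J_def mix_form)
  have "J (tikhonov \<tau>) < J g" if "g \<noteq> tikhonov \<tau>" for g
    using mix_form_pos[of \<tau> "g - tikhonov \<tau>"] that assms False by (simp add: J)
  then have "is_arg_min J (\<lambda>g. True) f \<longleftrightarrow> f = tikhonov \<tau>"
    unfolding is_arg_min_def by (metis less_irrefl order_less_asym)
  then show ?thesis using False by (simp add: regularization_solution_def J_def[abs_def])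
qed

text \<open>
  Since \<open>d\<close> is fixed by both projectors, \<open>\<langle>R f, d\<rangle> = \<langle>S f, d\<rangle>\<close>. So
  \<open>\<parallel>d\<parallel>\<^sup>2\<close> is the difference of the pairings of the two residuals with \<open>d\<close>, for any
  \<open>f\<close>.
\<close>

lemma norm_gap_le:
  assumes "consistent_set R S r s \<epsilon> \<eta> \<noteq> {}"
  shows "norm d \<le> \<epsilon> + \<eta>"
proof (cases "d = 0")
  case True
  with assms show ?thesis
    by (auto simp: consistent_set_def intro: order_trans[OF norm_ge_zero] add_nonneg_nonneg)
next
  case False
  from assms obtain f where f: "norm (R f - r) \<le> \<epsilon>" "norm (S f - s) \<le> \<eta>"
    by (auto simp: consistent_set_def)
  have "R f \<bullet> d = S f \<bullet> d" using R_adj[of f d] S_adj[of f d] Rd Sd by simp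
  moreover have "r \<bullet> d = s \<bullet> d - d \<bullet> d"
    using R_adj[of f\<^sub>0 d] S_adj[of f\<^sub>0 d] Rd Sd R_start S_start by (simp add: inner_diff_left)
  ultimately have "(norm d)\<^sup>2 = (R f - r) \<bullet> d - (S f - s) \<bullet> d"
    by (simp add: power2_norm_eq_inner inner_diff_left)
  also have "\<dots> \<le> norm (R f - r) * norm d + norm (S f - s) * norm d"
    using norm_cauchy_schwarz[of "R f - r" d] Cauchy_Schwarz_ineq2[of "S f - s" d] by linarith
  also have "\<dots> \<le> (\<epsilon> + \<eta>) * norm d"
    unfolding distrib_right[symmetric] using f by (intro mult_right_mono) auto
  finally show ?thesis using False by (simp add: power2_eq_square)
qed

text \<open>
  By \<open>residual_R_data\<close>, the first residual on \<open>S f = s\<close> depends only on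
  \<open>\<parallel>R (f - tikhonov 1)\<parallel>\<close>, so the set is symmetric about \<open>tikhonov 1\<close>. It is bounded
  because \<open>(R + S) / 2\<close> is positive definite.
\<close>

lemma chebyshev_center_exact_iff:
  assumes "consistent_set R S r s \<epsilon> 0 \<noteq> {}"
  shows "chebyshev_center (consistent_set R S r s \<epsilon> 0) g \<longleftrightarrow> g = tikhonov 1"
proof (rule chebyshev_center_unique_if_symmetric[OF _ assms])
  let ?C = "consistent_set R S r s \<epsilon> 0"
  show "2 *\<^sub>R tikhonov 1 - f \<in> ?C" if "f \<in> ?C" for f
  proof -
    from that have f: "S f = s" "norm (R f - r) \<le> \<epsilon>" by (auto simp: consistent_set_def)
    have S': "S (2 *\<^sub>R tikhonov 1 - f) = s"
      using f S_tikhonov_1 by (simp only: S.diff S.scaleR) (simp add: scaleR_2)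
    have mirror: "2 *\<^sub>R tikhonov 1 - f - tikhonov 1 = - (f - tikhonov 1)" by (simp add: scaleR_2)
    have "(norm (R (2 *\<^sub>R tikhonov 1 - f) - r))\<^sup>2 = (norm (R f - r))\<^sup>2"
      unfolding residual_R_data[OF S'] residual_R_data[OF f(1)] mirror R.neg norm_minus_cancel ..
    then have "norm (R (2 *\<^sub>R tikhonov 1 - f) - r) = norm (R f - r)" by simp
    with f S' show ?thesis by (simp add: consistent_set_def)
  qed
  have "continuous_on UNIV R" "continuous_on UNIV S"
    by (simp_all add: linear_continuous_on linear_conv_bounded_linear[symmetric] R.linear_axioms S.linear_axioms)
  then have "closed ?C"
    unfolding consistent_set_def by (intro closed_Collect_conj closed_Collect_le continuous_intros)
  moreover have "bounded ?C"
  proof -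
    have "norm (f - tikhonov (1/2)) \<le> sqrt (\<epsilon>\<^sup>2 / lam (1/2))" if "f \<in> ?C" for f
    proof -
      have "norm (R f - r) \<le> \<epsilon>" "norm (S f - s) \<le> 0" using that by (auto simp: consistent_set_def)
      then have "(norm (R f - r))\<^sup>2 \<le> \<epsilon>\<^sup>2" "(norm (S f - s))\<^sup>2 = 0" by (auto intro: power_mono)
      moreover have "lam (1/2) * (norm (f - tikhonov (1/2)))\<^sup>2
        \<le> (1/2) * (norm (R f - r))\<^sup>2 + (1/2) * (norm (S f - s))\<^sup>2"
      proof -
        have "(1/2) * (norm (R f - r))\<^sup>2 + (1/2) * (norm (S f - s))\<^sup>2
          = (1/4) * (norm d)\<^sup>2
            + ((1/2) * (norm (R (f - tikhonov (1/2))))\<^sup>2 + (1/2) * (norm (S (f - tikhonov (1/2))))\<^sup>2)"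
          using weighted_residual[of "1/2" "f - tikhonov (1/2)"] by simp
        moreover have "lam (1/2) * (norm (f - tikhonov (1/2)))\<^sup>2
          \<le> (1/2) * (norm (R (f - tikhonov (1/2))))\<^sup>2 + (1/2) * (norm (S (f - tikhonov (1/2))))\<^sup>2"
          using lam_le_form[of "1/2" "f - tikhonov (1/2)"] by simp
        ultimately show ?thesis using zero_le_power2[of "norm d"] by linarith
      qed
      ultimately have "lam (1/2) * (norm (f - tikhonov (1/2)))\<^sup>2 \<le> \<epsilon>\<^sup>2"
        using zero_le_power2[of \<epsilon>] by linarith
      then show ?thesis
        using lam_pos[of "1/2"] by (intro real_le_rsqrt) (simp add: field_simps)
    qed
    then show ?thesis
      unfolding bounded_any_center[where a = "tikhonov (1/2)"] by (auto simp: dist_norm norm_minus_commute)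
  qed
  ultimately show "compact ?C" by (simp add: compact_eq_bounded_closed)
qed

lemma chebyshev_center_iff:
  assumes \<tau>: "0 < \<tau>" "\<tau> < 1" and id: "R \<noteq> id" "S \<noteq> id" and \<epsilon>\<eta>: "0 \<le> \<epsilon>" "0 \<le> \<eta>"
    and feasible: "\<tau> * norm d \<le> \<epsilon>" "(1 - \<tau>) * norm d \<le> \<eta>"
    and balance: "(1 - \<tau>) * (1 - \<tau> - lam \<tau>) * (\<epsilon>\<^sup>2 - \<tau>\<^sup>2 * (norm d)\<^sup>2)
      = \<tau> * (\<tau> - lam \<tau>) * (\<eta>\<^sup>2 - (1 - \<tau>)\<^sup>2 * (norm d)\<^sup>2)"
  shows "chebyshev_center (consistent_set R S r s \<epsilon> \<eta>) g \<longleftrightarrow> g = tikhonov \<tau>"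
proof -
  define X Y where "X = \<epsilon>\<^sup>2 - \<tau>\<^sup>2 * (norm d)\<^sup>2" and "Y = \<eta>\<^sup>2 - (1 - \<tau>)\<^sup>2 * (norm d)\<^sup>2"
  have nonneg: "X \<ge> 0" "Y \<ge> 0"
    using power_mono[OF feasible(1), of 2] power_mono[OF feasible(2), of 2] \<tau>
    by (simp_all add: X_def Y_def power_mult_distrib)
  obtain h where h: "(norm (R h))\<^sup>2 = X" "(norm (S h))\<^sup>2 = Y"
    and radius: "lam \<tau> * (norm h)\<^sup>2 = (1 - \<tau>) * X + \<tau> * Y" and orth: "h \<bullet> d = 0"
  proof (rule extremal_displacement[OF \<tau> id nonneg balance[folded X_def Y_def]])
    fix h
    assume "(norm (R h))\<^sup>2 = X" "(norm (S h))\<^sup>2 = Y"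
      "lam \<tau> * (norm h)\<^sup>2 = (1 - \<tau>) * X + \<tau> * Y"
      and "\<And>w. R w = w \<Longrightarrow> S w = w \<Longrightarrow> h \<bullet> w = 0"
    from this(1-3) this(4)[OF Rd Sd] show thesis by (rule that)
  qed
  have mem: "tikhonov \<tau> + h' \<in> consistent_set R S r s \<epsilon> \<eta>"
    if "(norm (R h'))\<^sup>2 = X" "(norm (S h'))\<^sup>2 = Y" "h' \<bullet> d = 0" for h'
  proof -
    have "(norm (R (tikhonov \<tau> + h') - r))\<^sup>2 = \<epsilon>\<^sup>2" "(norm (S (tikhonov \<tau> + h') - s))\<^sup>2 = \<eta>\<^sup>2"
      unfolding residual_R residual_S using that by (simp_all add: X_def Y_def)
    then show ?thesis using \<epsilon>\<eta> by (simp add: consistent_set_def)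
  qed
  show ?thesis
  proof (rule chebyshev_center_unique_if_diameter)
    show "tikhonov \<tau> + h \<in> consistent_set R S r s \<epsilon> \<eta>" using h orth by (rule mem)
    show "tikhonov \<tau> - h \<in> consistent_set R S r s \<epsilon> \<eta>"
      using mem[of "- h"] h orth by (simp add: R.neg S.neg)
    show "norm (f - tikhonov \<tau>) \<le> norm h" if "f \<in> consistent_set R S r s \<epsilon> \<eta>" for f
    proof -
      let ?k = "f - tikhonov \<tau>"
      have "(norm (R f - r))\<^sup>2 \<le> \<epsilon>\<^sup>2" "(norm (S f - s))\<^sup>2 \<le> \<eta>\<^sup>2"
        using that by (auto simp: consistent_set_def intro: power_mono)
      then have "(1 - \<tau>) * (norm (R f - r))\<^sup>2 + \<tau> * (norm (S f - s))\<^sup>2 \<le> (1 - \<tau>) * \<epsilon>\<^sup>2 + \<tau> * \<eta>\<^sup>2"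
        using \<tau> by (intro add_mono mult_left_mono) auto
      then have "(1 - \<tau>) * (norm (R ?k))\<^sup>2 + \<tau> * (norm (S ?k))\<^sup>2
          \<le> (1 - \<tau>) * \<epsilon>\<^sup>2 + \<tau> * \<eta>\<^sup>2 - \<tau> * (1 - \<tau>) * (norm d)\<^sup>2"
        using weighted_residual[of \<tau> ?k] by simp
      also have "\<dots> = (1 - \<tau>) * X + \<tau> * Y"
        by (simp add: X_def Y_def algebra_simps power2_eq_square)
      finally have "lam \<tau> * (norm ?k)\<^sup>2 \<le> lam \<tau> * (norm h)\<^sup>2"
        using lam_le_form[of \<tau> ?k] radius by linarith
      then have "(norm ?k)\<^sup>2 \<le> (norm h)\<^sup>2" using lam_pos[OF \<tau>] by simp
      then show ?thesis by (rule power2_le_imp_le) simp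
    qed
  qed
qed

end

text \<open>
  Since \<open>\<delta> \<le> \<epsilon> + \<eta>\<close>, the two inequalities cannot fail together: if \<open>\<tau> \<delta> > \<epsilon>\<close>,
  then \<open>(1 - \<tau>) \<delta> < \<eta>\<close>. The two sides of \<open>balance\<close> then have opposite signs
  and vanish, which forces \<open>l = \<tau> = 1 - \<tau>\<close>. The statement for \<open>\<eta>\<close> is the instance with
  \<open>\<tau>\<close> replaced by \<open>1 - \<tau>\<close>.
\<close>

lemma balanced_residuals_feasible:
  fixes \<tau> l \<delta> \<epsilon> \<eta> :: real
  assumes \<tau>: "0 < \<tau>" "\<tau> < 1" and l: "l \<le> \<tau>" "l \<le> 1 - \<tau>" and "0 \<le> \<epsilon>" "0 \<le> \<eta>"
    and "0 \<le> \<delta>" "\<delta> \<le> \<epsilon> + \<eta>"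
    and balance: "(1 - \<tau>) * (1 - \<tau> - l) * (\<epsilon>\<^sup>2 - \<tau>\<^sup>2 * \<delta>\<^sup>2) = \<tau> * (\<tau> - l) * (\<eta>\<^sup>2 - (1 - \<tau>)\<^sup>2 * \<delta>\<^sup>2)"
    and half: "\<tau> = 1/2 \<Longrightarrow> \<tau> * \<delta> \<le> \<epsilon>"
  shows "\<tau> * \<delta> \<le> \<epsilon>"
proof (rule ccontr)
  assume gt: "\<not> \<tau> * \<delta> \<le> \<epsilon>"
  then have "\<epsilon>\<^sup>2 < (\<tau> * \<delta>)\<^sup>2" using \<open>0 \<le> \<epsilon>\<close> by (intro power_strict_mono) auto
  then have X: "\<epsilon>\<^sup>2 - \<tau>\<^sup>2 * \<delta>\<^sup>2 < 0" by (simp add: power_mult_distrib)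
  have "(1 - \<tau>) * \<delta> < \<eta>" using gt \<open>\<delta> \<le> \<epsilon> + \<eta>\<close> by (simp add: algebra_simps)
  then have "((1 - \<tau>) * \<delta>)\<^sup>2 < \<eta>\<^sup>2" using \<tau> \<open>0 \<le> \<delta>\<close> by (intro power_strict_mono) auto
  then have Y: "0 < \<eta>\<^sup>2 - (1 - \<tau>)\<^sup>2 * \<delta>\<^sup>2" by (simp add: power_mult_distrib)
  have "(1 - \<tau>) * (1 - \<tau> - l) * (\<epsilon>\<^sup>2 - \<tau>\<^sup>2 * \<delta>\<^sup>2) \<le> 0"
    using X \<tau> l by (intro mult_nonneg_nonpos) auto
  moreover have "0 \<le> \<tau> * (\<tau> - l) * (\<eta>\<^sup>2 - (1 - \<tau>)\<^sup>2 * \<delta>\<^sup>2)"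
    using Y \<tau> l by (intro mult_nonneg_nonneg) auto
  ultimately have "(1 - \<tau>) * (1 - \<tau> - l) * (\<epsilon>\<^sup>2 - \<tau>\<^sup>2 * \<delta>\<^sup>2) = 0"
    "\<tau> * (\<tau> - l) * (\<eta>\<^sup>2 - (1 - \<tau>)\<^sup>2 * \<delta>\<^sup>2) = 0"
    using balance by linarith+
  then have "1 - \<tau> - l = 0" "\<tau> - l = 0"
    unfolding mult_eq_0_iff using X Y \<tau> by linarith+
  then have "\<tau> = 1/2" by linarith
  with half gt show False by simp
qed

section \<open>The regularization solution as Chebyshev center\<close>

theorem theorem8:
  fixes R S :: "'a::euclidean_space \<Rightarrow> 'a" and r s :: 'a and \<epsilon> \<eta> \<delta> :: real
  assumes "\<epsilon> > 0" and "\<eta> \<ge> 0"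
    and "orthogonal_projector R" and "orthogonal_projector S"
    and "R \<noteq> id" and "S \<noteq> id"
    and "{f. R f = 0} \<inter> {f. S f = 0} = {0}"
    and "r \<in> range R" and "s \<in> range S"
    and "consistent_set R S r s \<epsilon> \<eta> \<noteq> {}"
    and "\<delta> = (LEAST d. d \<in> {norm (R f - r) | f. S f = s})"
  shows "is_minimum {norm (R f - r) | f. S f = s} \<delta> \<and>
    is_minimum {norm (S f - s) | f. R f = r} \<delta> \<and>
    (\<forall>\<tau>\<in>{min (1/2) (\<epsilon> / (\<epsilon> + \<eta>)) .. max (1/2) (\<epsilon> / (\<epsilon> + \<eta>))}.
       lambda_min (\<lambda>f. (1 - \<tau>) *\<^sub>R R f + \<tau> *\<^sub>R S f)
         - ((1 - \<tau>)\<^sup>2 * \<epsilon>\<^sup>2 - \<tau>\<^sup>2 * \<eta>\<^sup>2)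
           / ((1 - \<tau>) * \<epsilon>\<^sup>2 - \<tau> * \<eta>\<^sup>2 + (1 - \<tau>) * \<tau> * (1 - 2 * \<tau>) * \<delta>\<^sup>2) = 0 \<longrightarrow>
       (\<tau> = 1/2 \<longrightarrow> \<delta> \<le> 2 * min \<epsilon> \<eta>) \<longrightarrow>
       (\<exists>!f. regularization_solution R S r s \<tau> f) \<and>
       (\<forall>f. regularization_solution R S r s \<tau> f \<longleftrightarrow>
            chebyshev_center (consistent_set R S r s \<epsilon> \<eta>) f))"
proof -
  interpret transversal_projectors R S
  proof
    show "x = 0" if "R x = 0" "S x = 0" for x using assms(7) that by blast
  qed (fact assms)+
  obtain f\<^sub>0 d where "R d = d" "S d = d" "R f\<^sub>0 = r" "S f\<^sub>0 = s - d"
    using regularization_path_exists[OF assms(8,9)] .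
  then interpret regularization_path R S r s f\<^sub>0 d by unfold_locales
  have \<delta>: "\<delta> = norm d"
    unfolding assms(11) using is_minimum_R by (intro Least_equality) (auto simp: is_minimum_def)
  have center: "(\<exists>!f. regularization_solution R S r s \<tau> f) \<and>
      (\<forall>f. regularization_solution R S r s \<tau> f \<longleftrightarrow>
            chebyshev_center (consistent_set R S r s \<epsilon> \<eta>) f)"
    if range: "\<tau> \<in> {min (1/2) (\<epsilon> / (\<epsilon> + \<eta>)) .. max (1/2) (\<epsilon> / (\<epsilon> + \<eta>))}"
      and eq: "lam \<tau> - ((1 - \<tau>)\<^sup>2 * \<epsilon>\<^sup>2 - \<tau>\<^sup>2 * \<eta>\<^sup>2)
           / ((1 - \<tau>) * \<epsilon>\<^sup>2 - \<tau> * \<eta>\<^sup>2 + (1 - \<tau>) * \<tau> * (1 - 2 * \<tau>) * \<delta>\<^sup>2) = 0"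
      and half: "\<tau> = 1/2 \<longrightarrow> \<delta> \<le> 2 * min \<epsilon> \<eta>" for \<tau>
  proof -
    have "0 < \<epsilon> / (\<epsilon> + \<eta>)" "\<epsilon> / (\<epsilon> + \<eta>) \<le> 1" using assms(1,2) by simp_all
    with range have \<tau>: "0 < \<tau>" "\<tau> \<le> 1" by (auto simp: min_def max_def split: if_splits)
    have "chebyshev_center (consistent_set R S r s \<epsilon> \<eta>) f \<longleftrightarrow> f = tikhonov \<tau>" for f
    proof (cases "\<tau> = 1")
      case True
      with range have "1 \<le> \<epsilon> / (\<epsilon> + \<eta>)" by (auto simp: max_def split: if_splits)
      then have "\<eta> = 0" using assms(1,2) by (simp add: field_simps)
      with True assms(10) show ?thesis by (simp add: chebyshev_center_exact_iff)
    next
      case False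
      with \<tau> have "\<tau> < 1" by simp
      note bounds = lam_le[OF \<tau>(1) this assms(5,6)] and pos = lam_pos[OF \<tau>(1) this]
      let ?D = "(1 - \<tau>) * \<epsilon>\<^sup>2 - \<tau> * \<eta>\<^sup>2 + (1 - \<tau>) * \<tau> * (1 - 2 * \<tau>) * \<delta>\<^sup>2"
      have quot: "lam \<tau> = ((1 - \<tau>)\<^sup>2 * \<epsilon>\<^sup>2 - \<tau>\<^sup>2 * \<eta>\<^sup>2) / ?D"
        using eq by (simp only: right_minus_eq)
      \<comment> \<open>Division by zero yields \<open>0\<close>, which is not the smallest eigenvalue, as that is positive.\<close>
      have "?D \<noteq> 0"
      proof
        assume "?D = 0"
        with quot have "lam \<tau> = 0" by (simp only: div_by_0)
        with pos show False by simp
      qed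
      then have "lam \<tau> * ?D = (1 - \<tau>)\<^sup>2 * \<epsilon>\<^sup>2 - \<tau>\<^sup>2 * \<eta>\<^sup>2"
        using nonzero_eq_divide_eq[THEN iffD1, OF _ quot] by blast
      then have balance: "(1 - \<tau>) * (1 - \<tau> - lam \<tau>) * (\<epsilon>\<^sup>2 - \<tau>\<^sup>2 * \<delta>\<^sup>2)
          = \<tau> * (\<tau> - lam \<tau>) * (\<eta>\<^sup>2 - (1 - \<tau>)\<^sup>2 * \<delta>\<^sup>2)"
        by algebra
      have gap: "0 \<le> \<delta>" "\<delta> \<le> \<epsilon> + \<eta>" using norm_gap_le[OF assms(10)] by (simp_all add: \<delta>)
      have half_R: "\<tau> * \<delta> \<le> \<epsilon>" if "\<tau> = 1/2"
        using half[rule_format, OF that] unfolding that by linarith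
      have half_S: "(1 - \<tau>) * \<delta> \<le> \<eta>" if "1 - \<tau> = 1/2"
      proof -
        have "\<tau> = 1/2" using that by simp
        from half[rule_format, OF this] show ?thesis unfolding that by linarith
      qed
      have feasible_R: "\<tau> * \<delta> \<le> \<epsilon>"
        by (rule balanced_residuals_feasible[OF \<tau>(1) \<open>\<tau> < 1\<close> bounds less_imp_le[OF assms(1)]
              assms(2) gap balance half_R])
      have swap: "1 - (1 - \<tau>) = \<tau>" by simp
      have feasible_S: "(1 - \<tau>) * \<delta> \<le> \<eta>"
      proof (rule balanced_residuals_feasible[of "1 - \<tau>" "lam \<tau>" \<eta> \<epsilon> \<delta>])
        show "(1 - (1 - \<tau>)) * (1 - (1 - \<tau>) - lam \<tau>) * (\<eta>\<^sup>2 - (1 - \<tau>)\<^sup>2 * \<delta>\<^sup>2)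
            = (1 - \<tau>) * (1 - \<tau> - lam \<tau>) * (\<epsilon>\<^sup>2 - (1 - (1 - \<tau>))\<^sup>2 * \<delta>\<^sup>2)"
          unfolding swap by (rule balance[symmetric])
      qed (use \<tau>(1) \<open>\<tau> < 1\<close> bounds assms(1,2) gap in \<open>simp_all add: half_S\<close>)
      show ?thesis
        using chebyshev_center_iff[OF \<tau>(1) \<open>\<tau> < 1\<close> assms(5,6) less_imp_le[OF assms(1)] assms(2)
            feasible_R[unfolded \<delta>] feasible_S[unfolded \<delta>] balance[unfolded \<delta>]] .
    qed
    then show ?thesis using regularization_solution_iff[OF \<tau>] by auto
  qed
  show ?thesis
  proof (rule conjI[OF _ conjI])
    show "is_minimum {norm (R f - r) | f. S f = s} \<delta>"
      and "is_minimum {norm (S f - s) | f. R f = r} \<delta>"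
      unfolding \<delta> by (fact is_minimum_R, fact is_minimum_S)
  qed (intro ballI impI, rule center[unfolded mix_def])
qed

end
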